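(* Let $\mathcal{C}$ be a clutter on a finite vertex set and let $\mathcal{C}'$ be a parallelization of $\mathcal{C}$. If the edge ideal $I(\mathcal{C})$ is normal, then the edge ideal $I(\mathcal{C}')$ is normal.
   Context: A clutter with finite vertex set $X=\{x_1,\ldots,x_n\}$ is a family $E(\mathcal{C})$ of subsets of $X$ (edges), none of which is included in another. Its edge ideal $I(\mathcal{C})$ is the ideal of $K[x_1,\ldots,x_n]$ ($K$ a field) generated by all monomials $\prod_{x_i\in e}x_i$ with $e\in E(\mathcal{C})$. For a monomial ideal $I$, $\overline{I^i}=(\{x^a\mid\exists\,p\geq 1:\ (x^a)^p\in I^{pi}\})$ is the integral closure of $I^i$; $I$ is normal if $I^i=\overline{I^i}$ for all $i\geq 1$. Duplicating a vertex $x_i$ of $\mathcal{C}$ means extending $X$ by a new vertex $x_i'$ and replacing $E(\mathcal{C})$ by $E(\mathcal{C})\cup\{(e\setminus\{x_i\})\cup\{x_i'\}\mid x_i\in e\in E(\mathcal{C})\}$. The deletion of $x_i$, $\mathcal{C}\setminus\{x_i\}$, is formed by deleting the vertex $x_i$ and all edges containing $x_i$. A clutter obtained from $\mathcal{C}$ by a sequence of deletions and duplications of vertices is a parallelization of $\mathcal{C}$. *)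

theory Defs
  imports "HOL-Algebra.Ideal_Product" "HOL-Library.Poly_Mapping"
begin

definition clutter :: "'v set \<times> 'v set set \<Rightarrow> bool" where
  "clutter C \<longleftrightarrow> (case C of (X, E) \<Rightarrow>
     finite X \<and> E \<subseteq> Pow X \<and> (\<forall>e\<in>E. \<forall>f\<in>E. e \<subseteq> f \<longrightarrow> e = f))"

definition deletion :: "'v \<Rightarrow> 'v set \<times> 'v set set \<Rightarrow> 'v set \<times> 'v set set" where
  "deletion x C = (case C of (X, E) \<Rightarrow> (X - {x}, {e \<in> E. x \<notin> e}))"

definition duplication :: "'v \<Rightarrow> 'v \<Rightarrow> 'v set \<times> 'v set set \<Rightarrow> 'v set \<times> 'v set set" where
  "duplication x x' C = (case C of (X, E) \<Rightarrow>
     (insert x' X, E \<union> {(e - {x}) \<union> {x'} | e. e \<in> E \<and> x \<in> e}))"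

inductive parallelization :: "'v set \<times> 'v set set \<Rightarrow> 'v set \<times> 'v set set \<Rightarrow> bool" for C where
  refl: "parallelization C C"
| deletion: "parallelization C D \<Longrightarrow> x \<in> fst D \<Longrightarrow> parallelization C (deletion x D)"
| duplication: "parallelization C D \<Longrightarrow> x \<in> fst D \<Longrightarrow> x' \<notin> fst D \<Longrightarrow>
    parallelization C (duplication x x' D)"

text \<open>A polynomial is a finitely supported map from exponent vectors
  \<^typ>\<open>'v \<Rightarrow>\<^sub>0 nat\<close> to coefficients.  Since the vertex set \<open>X\<close> varies, the polynomial ring
  \<open>K[X]\<close> is the subring of those polynomials in which only variables from \<open>X\<close> occur.\<close>

definition mpoly_ring :: "'v set \<Rightarrow> (('v \<Rightarrow>\<^sub>0 nat) \<Rightarrow>\<^sub>0 'k::field) ring" where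
  "mpoly_ring X =
     \<lparr>carrier = {p. \<forall>a \<in> Poly_Mapping.keys p. Poly_Mapping.keys a \<subseteq> X},
      monoid.mult = (*), one = 1, ring.zero = 0, add = (+)\<rparr>"

lemma cring_mpoly_ring: "cring (mpoly_ring X :: (('v \<Rightarrow>\<^sub>0 nat) \<Rightarrow>\<^sub>0 'k::field) ring)"
proof (rule cringI)
  show "abelian_group (mpoly_ring X :: (('v \<Rightarrow>\<^sub>0 nat) \<Rightarrow>\<^sub>0 'k) ring)"
  proof (rule abelian_groupI, goal_cases)
    case (1 p q)
    then show ?case
      using Poly_Mapping.keys_add[of p q] by (fastforce simp: mpoly_ring_def)
  next
    case (6 p)
    then have "- p \<in> carrier (mpoly_ring X)"
      by (simp add: mpoly_ring_def)
    then show ?case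
      by (intro bexI[of _ "- p"]) (auto simp: mpoly_ring_def)
  qed (auto simp: mpoly_ring_def add.assoc add.commute)
  show "Group.comm_monoid (mpoly_ring X :: (('v \<Rightarrow>\<^sub>0 nat) \<Rightarrow>\<^sub>0 'k) ring)"
  proof (rule comm_monoidI, goal_cases)
    case (1 p q)
    have "Poly_Mapping.keys a \<subseteq> X" if "a \<in> Poly_Mapping.keys (p * q)" for a
    proof -
      from that obtain b c where bc: "b \<in> Poly_Mapping.keys p" "c \<in> Poly_Mapping.keys q"
        and a: "a = b + c"
        using Poly_Mapping.keys_mult[of p q] by blast
      from bc 1 have "Poly_Mapping.keys b \<subseteq> X" "Poly_Mapping.keys c \<subseteq> X"
        by (auto simp: mpoly_ring_def)
      then show ?thesis
        using Poly_Mapping.keys_add[of b c] a by blast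
    qed
    then show ?case
      by (simp add: mpoly_ring_def)
  qed (auto simp: mpoly_ring_def mult.assoc mult.commute)
qed (simp add: mpoly_ring_def algebra_simps)

definition monomial :: "('v \<Rightarrow>\<^sub>0 nat) \<Rightarrow> ('v \<Rightarrow>\<^sub>0 nat) \<Rightarrow>\<^sub>0 'k::field" where
  "monomial a = Poly_Mapping.single a 1"

definition mpoly_var :: "'v \<Rightarrow> ('v \<Rightarrow>\<^sub>0 nat) \<Rightarrow>\<^sub>0 'k::field" where
  "mpoly_var x = monomial (Poly_Mapping.single x 1)"

definition edge_ideal :: "'v set \<times> 'v set set \<Rightarrow> (('v \<Rightarrow>\<^sub>0 nat) \<Rightarrow>\<^sub>0 'k::field) set" where
  "edge_ideal C = genideal (mpoly_ring (fst C)) {\<Prod>x\<in>e. mpoly_var x | e. e \<in> snd C}"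

definition ideal_power ::
  "'v set \<Rightarrow> (('v \<Rightarrow>\<^sub>0 nat) \<Rightarrow>\<^sub>0 'k::field) set \<Rightarrow> nat \<Rightarrow> (('v \<Rightarrow>\<^sub>0 nat) \<Rightarrow>\<^sub>0 'k) set" where
  "ideal_power X I i = I [^]\<^bsub>ideals_set (mpoly_ring X)\<^esub> i"

text \<open>The integral closure of \<open>I\<^sup>i\<close>, for a monomial ideal \<open>I\<close> of \<open>K[X]\<close>.\<close>

definition integral_closure_power ::
  "'v set \<Rightarrow> (('v \<Rightarrow>\<^sub>0 nat) \<Rightarrow>\<^sub>0 'k::field) set \<Rightarrow> nat \<Rightarrow> (('v \<Rightarrow>\<^sub>0 nat) \<Rightarrow>\<^sub>0 'k) set" where
  "integral_closure_power X I i = genideal (mpoly_ring X)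
     {monomial a | a. Poly_Mapping.keys a \<subseteq> X \<and> (\<exists>p\<ge>1. monomial a ^ p \<in> ideal_power X I (p * i))}"

definition normal_ideal :: "'v set \<Rightarrow> (('v \<Rightarrow>\<^sub>0 nat) \<Rightarrow>\<^sub>0 'k::field) set \<Rightarrow> bool" where
  "normal_ideal X I \<longleftrightarrow> (\<forall>i\<ge>1. ideal_power X I i = integral_closure_power X I i)"

end

theory Submission
  imports Defs
begin

text \<open>The powers of an edge ideal are monomial ideals: \<open>x\<^sup>a \<in> I\<^sup>i\<close> iff some list of \<open>i\<close> edges
  covers no vertex \<open>x\<close> more than \<open>a x\<close> times.  Normality thus says that \<open>a\<close> admits such a list
  of \<open>i\<close> edges as soon as some multiple \<open>p a\<close> admits one of \<open>p i\<close> edges.  Deletion only restricts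
  attention to the vectors \<open>a\<close> with \<open>a x = 0\<close>.  For the duplication of \<open>x\<close> by \<open>x'\<close>, merge the two
  vertices: \<open>a x + a x'\<close> becomes the exponent of \<open>x\<close>, one obtains a list of \<open>i\<close> edges of the
  original clutter, and as at most \<open>a x + a x'\<close> of them contain \<open>x\<close>, one may keep \<open>x\<close> in at most
  \<open>a x\<close> of these edges and replace it by \<open>x'\<close> in at most \<open>a x'\<close> others.\<close>

section \<open>Monomial ideals\<close>

text \<open>The ideal generated by the x^b with b in \<open>A\<close>, described through supports: a
  polynomial lies in a monomial ideal iff each of its monomials does. \<open>A\<close> may contain
  vectors not supported in \<open>X\<close>; these generate nothing, because
  \<open>a = b + c\<close> puts the keys of \<open>b\<close> among those of
  \<open>a\<close>.\<close>

definition monomial_ideal ::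
  "'v set \<Rightarrow> ('v \<Rightarrow>\<^sub>0 nat) set \<Rightarrow> (('v \<Rightarrow>\<^sub>0 nat) \<Rightarrow>\<^sub>0 'k::field) set" where
  "monomial_ideal X A =
     {p. \<forall>a \<in> Poly_Mapping.keys p. Poly_Mapping.keys a \<subseteq> X \<and> (\<exists>b\<in>A. \<exists>c. a = b + c)}"

text \<open>Natural exponents cannot cancel, so this is an equality and not a mere inclusion.
  Summands of a vector supported in \<open>X\<close> are thus supported in \<open>X\<close>
  too.\<close>

lemma keys_add_nat:
  fixes b c :: "'v \<Rightarrow>\<^sub>0 nat"
  shows "Poly_Mapping.keys (b + c) = Poly_Mapping.keys b \<union> Poly_Mapping.keys c"
  by (auto simp: in_keys_iff lookup_add)

lemma monomial_mult: "monomial a * monomial b = monomial (a + b)"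
  by (simp add: monomial_def mult_single)

lemma keys_monomial [simp]: "Poly_Mapping.keys (monomial a) = {a}"
  by (simp add: monomial_def)

lemma monomial_in_carrier [simp]:
  "monomial a \<in> carrier (mpoly_ring X) \<longleftrightarrow> Poly_Mapping.keys a \<subseteq> X"
  by (simp add: mpoly_ring_def)

lemma monomial_in_monomial_ideal [simp]:
  "monomial a \<in> monomial_ideal X A \<longleftrightarrow>
     Poly_Mapping.keys a \<subseteq> X \<and> (\<exists>b\<in>A. \<exists>c. a = b + c)"
  by (simp add: monomial_ideal_def)

lemma exists_summand_self:
  fixes a :: "'a::comm_monoid_add"
  shows "a \<in> A \<Longrightarrow> \<exists>b\<in>A. \<exists>c. a = b + c"
  by (metis add_0_right)

text \<open>Each exponent of \<open>q * p\<close> is one of \<open>q\<close> plus one of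
  \<open>p\<close>, hence keeps its summand from \<open>A\<close>; the support of a sum lies in the
  union of the supports.\<close>

lemma ideal_monomial_ideal:
  "ideal (monomial_ideal X A) (mpoly_ring X :: (('v \<Rightarrow>\<^sub>0 nat) \<Rightarrow>\<^sub>0 'k::field) ring)"
proof -
  interpret cring "mpoly_ring X :: (('v \<Rightarrow>\<^sub>0 nat) \<Rightarrow>\<^sub>0 'k) ring"
    by (rule cring_mpoly_ring)
  let ?I = "monomial_ideal X A :: (('v \<Rightarrow>\<^sub>0 nat) \<Rightarrow>\<^sub>0 'k) set"
  have mult: "q * p \<in> ?I" if p: "p \<in> ?I" and q: "q \<in> carrier (mpoly_ring X)" for p q
    unfolding monomial_ideal_def
  proof (rule CollectI, rule ballI)
    fix a assume "a \<in> Poly_Mapping.keys (q * p)"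
    then obtain d e where d: "d \<in> Poly_Mapping.keys q" and e: "e \<in> Poly_Mapping.keys p"
      and a: "a = d + e"
      using keys_mult by blast
    from p e obtain b c where "b \<in> A" "e = b + c" "Poly_Mapping.keys e \<subseteq> X"
      unfolding monomial_ideal_def by blast
    moreover from q d have "Poly_Mapping.keys d \<subseteq> X"
      by (auto simp: mpoly_ring_def)
    moreover from a \<open>e = b + c\<close> have "a = b + (c + d)"
      by (simp add: ac_simps)
    ultimately show "Poly_Mapping.keys a \<subseteq> X \<and> (\<exists>b\<in>A. \<exists>c. a = b + c)"
      unfolding a by (auto simp: keys_add_nat)
  qed
  show ?thesis
  proof (rule idealI)
    show "ring (mpoly_ring X :: (('v \<Rightarrow>\<^sub>0 nat) \<Rightarrow>\<^sub>0 'k) ring)" ..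
    show "subgroup ?I (add_monoid (mpoly_ring X))"
    proof (rule add.subgroupI)
      show "?I \<subseteq> carrier (mpoly_ring X)"
        by (auto simp: monomial_ideal_def mpoly_ring_def)
      have "0 \<in> ?I"
        by (simp add: monomial_ideal_def)
      then show "?I \<noteq> {}" by blast
      fix p q :: "('v \<Rightarrow>\<^sub>0 nat) \<Rightarrow>\<^sub>0 'k" assume pq: "p \<in> ?I" "q \<in> ?I"
      from pq show "p \<oplus>\<^bsub>mpoly_ring X\<^esub> q \<in> ?I"
        using Poly_Mapping.keys_add[of p q] unfolding monomial_ideal_def mpoly_ring_def
        by auto
    next
      fix p :: "('v \<Rightarrow>\<^sub>0 nat) \<Rightarrow>\<^sub>0 'k" assume p: "p \<in> ?I"
      then have "p \<in> carrier (mpoly_ring X)" "- p \<in> carrier (mpoly_ring X)"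
        by (auto simp: monomial_ideal_def mpoly_ring_def)
      then have "\<ominus>\<^bsub>mpoly_ring X\<^esub> p = - p"
        by (intro minus_equality) (auto simp: mpoly_ring_def)
      with p show "\<ominus>\<^bsub>mpoly_ring X\<^esub> p \<in> ?I"
        by (simp add: monomial_ideal_def)
    qed
  qed (use mult in \<open>auto simp: mpoly_ring_def mult.commute\<close>)
qed

lemma poly_mapping_eq_sum_single:
  "p = (\<Sum>a\<in>Poly_Mapping.keys p. Poly_Mapping.single a (Poly_Mapping.lookup p a))"
  by (rule poly_mapping_eqI) (simp add: lookup_sum lookup_single when_def in_keys_iff)

text \<open>Every polynomial is the sum of its terms, and each term here is a multiple of some
  monomial x^b in \<open>J\<close>.\<close>

lemma monomial_ideal_subset:
  fixes J :: "(('v \<Rightarrow>\<^sub>0 nat) \<Rightarrow>\<^sub>0 'k::field) set"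
  assumes J: "ideal J (mpoly_ring X)"
    and gens: "\<And>b. b \<in> A \<Longrightarrow> Poly_Mapping.keys b \<subseteq> X \<Longrightarrow> monomial b \<in> J"
  shows "monomial_ideal X A \<subseteq> J"
proof
  fix p :: "('v \<Rightarrow>\<^sub>0 nat) \<Rightarrow>\<^sub>0 'k"
  interpret ideal J "mpoly_ring X" by (rule J)
  assume p: "p \<in> monomial_ideal X A"
  have single: "Poly_Mapping.single a (Poly_Mapping.lookup p a) \<in> J"
    if "a \<in> Poly_Mapping.keys p" for a
  proof -
    from p that obtain b c where b: "b \<in> A" and a: "a = b + c" and "Poly_Mapping.keys a \<subseteq> X"
      unfolding monomial_ideal_def by blast
    then have keys: "Poly_Mapping.keys b \<subseteq> X" "Poly_Mapping.keys c \<subseteq> X"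
      by (auto simp: keys_add_nat)
    \<comment> \<open>The coefficient goes into the cofactor, as x^b itself has coefficient
      1.\<close>
    have "Poly_Mapping.single c (Poly_Mapping.lookup p a) \<in> carrier (mpoly_ring X)"
      using keys by (auto simp: mpoly_ring_def)
    from I_r_closed[OF gens[OF b keys(1)] this] show ?thesis
      by (simp add: mpoly_ring_def monomial_def mult_single a)
  qed
  have "(\<Sum>a\<in>S. Poly_Mapping.single a (Poly_Mapping.lookup p a)) \<in> J"
    if "S \<subseteq> Poly_Mapping.keys p" for S
    using finite_subset[OF that finite_keys] that
  proof (induction S rule: finite_induct)
    case empty
    show ?case
      using additive_subgroup.zero_closed[OF additive_subgroup_axioms] by (simp add: mpoly_ring_def)
  next
    case (insert a S)
    then show ?case
      using additive_subgroup.a_closed[OF additive_subgroup_axioms, of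
          "Poly_Mapping.single a (Poly_Mapping.lookup p a)"] single[of a]
      by (simp add: mpoly_ring_def)
  qed
  from this[of "Poly_Mapping.keys p"] show "p \<in> J"
    by (simp flip: poly_mapping_eq_sum_single)
qed

text \<open>Links generated ideals, in terms of which edge ideals and integral closures are defined,
  to the description by supports.\<close>

lemma genideal_monomials:
  "genideal (mpoly_ring X) {monomial a | a. Poly_Mapping.keys a \<subseteq> X \<and> a \<in> A} =
     (monomial_ideal X A :: (('v \<Rightarrow>\<^sub>0 nat) \<Rightarrow>\<^sub>0 'k::field) set)"
  (is "genideal _ ?G = _")
proof
  interpret cring "mpoly_ring X :: (('v \<Rightarrow>\<^sub>0 nat) \<Rightarrow>\<^sub>0 'k) ring"
    by (rule cring_mpoly_ring)
  have "?G \<subseteq> carrier (mpoly_ring X)" by auto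
  then show "monomial_ideal X A \<subseteq> genideal (mpoly_ring X) ?G"
    using genideal_self[of ?G] by (intro monomial_ideal_subset genideal_ideal) auto
  show "genideal (mpoly_ring X) ?G \<subseteq> monomial_ideal X A"
    by (intro genideal_minimal ideal_monomial_ideal) (auto simp: exists_summand_self)
qed

text \<open>Generators multiply by adding exponents; conversely, a multiple of x^a times a multiple
  of x^b is a multiple of x^(a+b).\<close>

lemma ideal_prod_monomial_ideal:
  "ideal_prod (mpoly_ring X) (monomial_ideal X A) (monomial_ideal X B) =
     (monomial_ideal X {a + b | a b. a \<in> A \<and> b \<in> B} :: (('v \<Rightarrow>\<^sub>0 nat) \<Rightarrow>\<^sub>0 'k::field) set)"
  (is "?L = ?R")
proof
  interpret cring "mpoly_ring X :: (('v \<Rightarrow>\<^sub>0 nat) \<Rightarrow>\<^sub>0 'k) ring"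
    by (rule cring_mpoly_ring)
  interpret R: ideal ?R "mpoly_ring X" by (rule ideal_monomial_ideal)
  show "?R \<subseteq> ?L"
  proof (rule monomial_ideal_subset)
    show "ideal ?L (mpoly_ring X)"
      by (intro ideal_prod_is_ideal ideal_monomial_ideal)
    fix d assume "d \<in> {a + b | a b. a \<in> A \<and> b \<in> B}" "Poly_Mapping.keys d \<subseteq> X"
    then obtain a b where "a \<in> A" "b \<in> B" "d = a + b"
      "Poly_Mapping.keys a \<subseteq> X" "Poly_Mapping.keys b \<subseteq> X"
      by (auto simp: keys_add_nat)
    then have "monomial a \<in> monomial_ideal X A" "monomial b \<in> monomial_ideal X B"
      by (simp_all add: exists_summand_self)
    from ideal_prod.prod[OF this, of "mpoly_ring X"] show "monomial d \<in> ?L"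
      by (simp add: mpoly_ring_def monomial_mult \<open>d = a + b\<close>)
  qed
  show "?L \<subseteq> ?R"
  proof
    fix p assume "p \<in> ?L"
    then show "p \<in> ?R"
    proof induction
      case (prod p q)
      show ?case
        unfolding monomial_ideal_def
      proof (rule CollectI, rule ballI)
        fix d assume "d \<in> Poly_Mapping.keys (p \<otimes>\<^bsub>mpoly_ring X\<^esub> q)"
        then obtain a b where "a \<in> Poly_Mapping.keys p" "b \<in> Poly_Mapping.keys q" and d: "d = a + b"
          using keys_mult[of p q] by (auto simp: mpoly_ring_def)
        with prod obtain a' ca b' cb where *: "a' \<in> A" "a = a' + ca" "b' \<in> B" "b = b' + cb"
          and "Poly_Mapping.keys a \<subseteq> X" "Poly_Mapping.keys b \<subseteq> X"
          unfolding monomial_ideal_def by blast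
        moreover have "d = (a' + b') + (ca + cb)"
          by (simp add: d * ac_simps)
        ultimately show "Poly_Mapping.keys d \<subseteq> X \<and>
            (\<exists>b\<in>{a + b | a b. a \<in> A \<and> b \<in> B}. \<exists>c. d = b + c)"
          unfolding d by (metis (mono_tags, lifting) keys_add_nat le_sup_iff mem_Collect_eq)
      qed
    qed (rule additive_subgroup.a_closed[OF R.additive_subgroup_axioms])
  qed
qed

lemma monomial_ideal_zero: "monomial_ideal X {0} = carrier (mpoly_ring X)"
  by (auto simp: monomial_ideal_def mpoly_ring_def)

section \<open>Powers of edge ideals\<close>

text \<open>For finite \<open>e\<close>, its characteristic vector.\<close>

definition edge_exponent :: "'v set \<Rightarrow> 'v \<Rightarrow>\<^sub>0 nat" where
  "edge_exponent e = (\<Sum>x\<in>e. Poly_Mapping.single x 1)"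

text \<open>The exponents of the \<open>n\<close>-fold products of generators of the edge ideal.
  Lists are used since an edge may occur repeatedly.\<close>

definition edge_sums :: "'v set set \<Rightarrow> nat \<Rightarrow> ('v \<Rightarrow>\<^sub>0 nat) set" where
  "edge_sums E n = {sum_list (map edge_exponent es) | es. length es = n \<and> set es \<subseteq> E}"

definition mult_in :: "'v set list \<Rightarrow> 'v \<Rightarrow> nat" where
  "mult_in es x = length (filter (\<lambda>e. x \<in> e) es)"

text \<open>For \<open>f\<close> supported in \<open>X\<close> this says that x^f lies in the
  \<open>n\<close>-th power of the edge ideal. With plain functions, vectors such as
  \<open>\<lambda>x. p * f x\<close> can be written directly.\<close>

definition packs :: "'v set set \<Rightarrow> nat \<Rightarrow> ('v \<Rightarrow> nat) \<Rightarrow> bool" where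
  "packs E n f \<longleftrightarrow> (\<exists>es. length es = n \<and> set es \<subseteq> E \<and> (\<forall>x. mult_in es x \<le> f x))"

lemma mult_in_simps [simp]:
  "mult_in [] x = 0"
  "mult_in (e # es) x = (if x \<in> e then Suc (mult_in es x) else mult_in es x)"
  by (simp_all add: mult_in_def)

lemma prod_mpoly_var:
  "finite e \<Longrightarrow> (\<Prod>x\<in>e. mpoly_var x) = monomial (edge_exponent e)"
  unfolding edge_exponent_def
  by (induction e rule: finite_induct)
    (simp_all add: mpoly_var_def monomial_mult, simp add: monomial_def)

lemma lookup_edge_exponent:
  "finite e \<Longrightarrow> Poly_Mapping.lookup (edge_exponent e) x = (if x \<in> e then 1 else 0)"
  by (simp add: edge_exponent_def lookup_sum lookup_single when_def)

lemma keys_edge_exponent: "finite e \<Longrightarrow> Poly_Mapping.keys (edge_exponent e) = e"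
  by (auto simp: in_keys_iff lookup_edge_exponent split: if_splits)

lemma edge_ideal_eq:
  assumes "finite X" "E \<subseteq> Pow X"
  shows "(edge_ideal (X, E) :: (('v \<Rightarrow>\<^sub>0 nat) \<Rightarrow>\<^sub>0 'k::field) set) = monomial_ideal X (edge_exponent ` E)"
proof -
  have fin: "finite e" if "e \<in> E" for e
    using assms that by (meson PowD finite_subset subsetD)
  have "{\<Prod>x\<in>e. mpoly_var x :: ('v \<Rightarrow>\<^sub>0 nat) \<Rightarrow>\<^sub>0 'k | e. e \<in> E} =
       {monomial (edge_exponent e) | e. e \<in> E}"
    using fin by (metis (no_types, opaque_lifting) prod_mpoly_var)
  also have "\<dots> = {monomial a | a. Poly_Mapping.keys a \<subseteq> X \<and> a \<in> edge_exponent ` E}"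
  proof (intro Collect_cong iffI)
    fix p :: "('v \<Rightarrow>\<^sub>0 nat) \<Rightarrow>\<^sub>0 'k"
    assume "\<exists>e. p = monomial (edge_exponent e) \<and> e \<in> E"
    then obtain e where "e \<in> E" "p = monomial (edge_exponent e)" by blast
    moreover from this have "Poly_Mapping.keys (edge_exponent e) \<subseteq> X"
      using fin assms(2) by (auto simp: keys_edge_exponent)
    ultimately show "\<exists>a. p = monomial a \<and> Poly_Mapping.keys a \<subseteq> X \<and> a \<in> edge_exponent ` E"
      by blast
  qed blast
  finally show ?thesis
    by (simp add: edge_ideal_def genideal_monomials)
qed

lemma edge_sums_0: "edge_sums E 0 = {0}"
  by (auto simp: edge_sums_def)

lemma edge_sums_Suc:
  "edge_sums E (Suc n) = {a + b | a b. a \<in> edge_sums E n \<and> b \<in> edge_exponent ` E}"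
proof (intro equalityI subsetI)
  fix d assume "d \<in> edge_sums E (Suc n)"
  then obtain e es where "length es = n" "set es \<subseteq> E" "e \<in> E"
    "d = sum_list (map edge_exponent es) + edge_exponent e"
    by (auto simp: edge_sums_def length_Suc_conv add.commute)
  then show "d \<in> {a + b | a b. a \<in> edge_sums E n \<and> b \<in> edge_exponent ` E}"
    unfolding edge_sums_def by blast
next
  fix d assume "d \<in> {a + b | a b. a \<in> edge_sums E n \<and> b \<in> edge_exponent ` E}"
  then obtain e es where "length es = n" "set es \<subseteq> E" "e \<in> E"
    "d = sum_list (map edge_exponent es) + edge_exponent e"
    by (auto simp: edge_sums_def)
  then have "d = sum_list (map edge_exponent (e # es))" "length (e # es) = Suc n" "set (e # es) \<subseteq> E"
    by (simp_all add: add.commute)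
  then show "d \<in> edge_sums E (Suc n)"
    unfolding edge_sums_def by blast
qed

lemma ideal_power_edge_ideal:
  assumes "finite X" "E \<subseteq> Pow X"
  shows "ideal_power X (edge_ideal (X, E) :: (('v \<Rightarrow>\<^sub>0 nat) \<Rightarrow>\<^sub>0 'k::field) set) n =
    monomial_ideal X (edge_sums E n)"
proof (induction n)
  case 0
  show ?case
    \<comment> \<open>The unit of the monoid of ideals is the whole ring, which x^0
      generates.\<close>
    by (simp add: ideal_power_def ideals_set_def nat_pow_def edge_sums_0 monomial_ideal_zero)
next
  case (Suc n)
  let ?I = "edge_ideal (X, E) :: (('v \<Rightarrow>\<^sub>0 nat) \<Rightarrow>\<^sub>0 'k) set"
  have "ideal_power X ?I (Suc n) = ideal_prod (mpoly_ring X) (ideal_power X ?I n) ?I"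
    by (simp add: ideal_power_def ideals_set_def nat_pow_def)
  also have "\<dots> = ideal_prod (mpoly_ring X) (monomial_ideal X (edge_sums E n))
      (monomial_ideal X (edge_exponent ` E))"
    by (simp only: Suc.IH) (simp only: edge_ideal_eq[OF assms])
  also have "\<dots> = monomial_ideal X (edge_sums E (Suc n))"
    by (simp only: ideal_prod_monomial_ideal edge_sums_Suc)
  finally show ?case .
qed

section \<open>Normality as a packing property of edges\<close>

lemma lookup_sum_list_edges:
  assumes "\<And>e. e \<in> set es \<Longrightarrow> finite e"
  shows "Poly_Mapping.lookup (sum_list (map edge_exponent es)) x = mult_in es x"
  using assms by (induction es) (auto simp: lookup_add lookup_edge_exponent)

lemma exists_add_iff_lookup_le:
  fixes a b :: "'v \<Rightarrow>\<^sub>0 nat"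
  shows "(\<exists>c. a = b + c) \<longleftrightarrow> (\<forall>x. Poly_Mapping.lookup b x \<le> Poly_Mapping.lookup a x)"
proof
  assume "\<forall>x. Poly_Mapping.lookup b x \<le> Poly_Mapping.lookup a x"
  then have "a = b + (a - b)"
    by (intro poly_mapping_eqI) (simp add: lookup_add lookup_minus)
  then show "\<exists>c. a = b + c" ..
qed (auto simp: lookup_add)

text \<open>Divisibility of monomials is coordinatewise comparison, and the coordinate at
  \<open>x\<close> of a sum of edge vectors counts the edges containing \<open>x\<close>.\<close>

lemma edge_sums_divides_iff_packs:
  assumes "finite X" "E \<subseteq> Pow X"
  shows "(\<exists>b\<in>edge_sums E n. \<exists>c. a = b + c) \<longleftrightarrow> packs E n (Poly_Mapping.lookup a)"
proof -
  have fin: "finite e" if "e \<in> E" for e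
    using assms that by (meson PowD finite_subset subsetD)
  have "(\<exists>b\<in>edge_sums E n. \<exists>c. a = b + c) \<longleftrightarrow>
      (\<exists>es. length es = n \<and> set es \<subseteq> E \<and>
        (\<forall>x. Poly_Mapping.lookup (sum_list (map edge_exponent es)) x \<le> Poly_Mapping.lookup a x))"
    unfolding exists_add_iff_lookup_le edge_sums_def by blast
  also have "\<dots> \<longleftrightarrow> packs E n (Poly_Mapping.lookup a)"
    unfolding packs_def
    by (intro ex_cong1 conj_cong refl) (auto simp: lookup_sum_list_edges fin subset_iff)
  finally show ?thesis .
qed

lemma monomial_power: "monomial a ^ p = monomial (\<Sum>j<p. a)"
  by (induction p) (simp_all add: monomial_mult add.commute, simp add: monomial_def)

text \<open>Removes the polynomial ring and the field from the problem: I^i and its integral closure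
  are both monomial ideals, and such ideals agree iff they contain the same monomials.\<close>

lemma normal_edge_ideal_iff:
  assumes "finite X" "E \<subseteq> Pow X"
  shows "normal_ideal X (edge_ideal (X, E) :: (('v \<Rightarrow>\<^sub>0 nat) \<Rightarrow>\<^sub>0 'k::field) set) \<longleftrightarrow>
    (\<forall>i\<ge>1. \<forall>f p. (\<forall>x. x \<notin> X \<longrightarrow> f x = 0) \<longrightarrow> p \<ge> 1 \<longrightarrow> packs E (p * i) (\<lambda>x. p * f x) \<longrightarrow> packs E i f)"
    (is "_ = ?R")
proof -
  let ?I = "edge_ideal (X, E) :: (('v \<Rightarrow>\<^sub>0 nat) \<Rightarrow>\<^sub>0 'k) set"
  \<comment> \<open>Exponents of the generators of the integral closure of I^i, up to the support
    condition.\<close>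
  let ?A = "\<lambda>i. {a. \<exists>p\<ge>1. packs E (p * i) (\<lambda>x. p * Poly_Mapping.lookup a x)}"
  have power: "(monomial a :: _ \<Rightarrow>\<^sub>0 'k) ^ p \<in> ideal_power X ?I (p * i) \<longleftrightarrow>
      packs E (p * i) (\<lambda>x. p * Poly_Mapping.lookup a x)"
    if "Poly_Mapping.keys a \<subseteq> X" for a p i
  proof -
    have lookup: "Poly_Mapping.lookup (\<Sum>j<p. a) = (\<lambda>x. p * Poly_Mapping.lookup a x)"
      by (simp add: lookup_sum fun_eq_iff)
    then have "Poly_Mapping.keys (\<Sum>j<p. a) \<subseteq> X"
      using that by (auto simp: in_keys_iff)
    then show ?thesis
      by (simp add: monomial_power ideal_power_edge_ideal[OF assms]
          edge_sums_divides_iff_packs[OF assms] lookup)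
  qed
  have closure: "integral_closure_power X ?I i = monomial_ideal X (?A i)" for i
    unfolding integral_closure_power_def genideal_monomials[symmetric]
    using power by (intro arg_cong[where f = "genideal (mpoly_ring X)"]) blast
  \<comment> \<open>Carries the packing from a generator of the closure over to its
    multiples.\<close>
  have packs_add: "packs E i (Poly_Mapping.lookup b) \<Longrightarrow>
      packs E i (Poly_Mapping.lookup (b + c))" for b c i
    unfolding packs_def by (auto simp: lookup_add intro: trans_le_add1)
  have eq: "ideal_power X ?I i = integral_closure_power X ?I i \<longleftrightarrow>
      (\<forall>a. Poly_Mapping.keys a \<subseteq> X \<longrightarrow> a \<in> ?A i \<longrightarrow> packs E i (Poly_Mapping.lookup a))" for i
  proof
    assume *: "ideal_power X ?I i = integral_closure_power X ?I i"
    show "\<forall>a. Poly_Mapping.keys a \<subseteq> X \<longrightarrow> a \<in> ?A i \<longrightarrow> packs E i (Poly_Mapping.lookup a)"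
    proof (intro allI impI)
      fix a assume a: "Poly_Mapping.keys a \<subseteq> X" "a \<in> ?A i"
      then have "(monomial a :: _ \<Rightarrow>\<^sub>0 'k) \<in> monomial_ideal X (?A i)"
        unfolding monomial_in_monomial_ideal by (intro conjI exists_summand_self)
      then have "(monomial a :: _ \<Rightarrow>\<^sub>0 'k) \<in> monomial_ideal X (edge_sums E i)"
        using * by (simp add: closure ideal_power_edge_ideal[OF assms])
      then show "packs E i (Poly_Mapping.lookup a)"
        by (simp add: edge_sums_divides_iff_packs[OF assms])
    qed
  next
    assume *: "\<forall>a. Poly_Mapping.keys a \<subseteq> X \<longrightarrow> a \<in> ?A i \<longrightarrow> packs E i (Poly_Mapping.lookup a)"
    have "(\<exists>b\<in>edge_sums E i. \<exists>c. a = b + c) \<longleftrightarrow> (\<exists>b\<in>?A i. \<exists>c. a = b + c)"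
      if a: "Poly_Mapping.keys a \<subseteq> X" for a
    proof
      assume "\<exists>b\<in>edge_sums E i. \<exists>c. a = b + c"
      \<comment> \<open>The choice \<open>p = 1\<close> shows that I^i lies in its integral
        closure.\<close>
      then have "packs E (1 * i) (\<lambda>x. 1 * Poly_Mapping.lookup a x)"
        by (simp add: edge_sums_divides_iff_packs[OF assms])
      then have "a \<in> ?A i" by blast
      then show "\<exists>b\<in>?A i. \<exists>c. a = b + c" by (rule exists_summand_self)
    next
      assume "\<exists>b\<in>?A i. \<exists>c. a = b + c"
      then obtain b c where b: "b \<in> ?A i" "a = b + c" by blast
      \<comment> \<open>The assumption covers vectors supported in \<open>X\<close>;
        \<open>b\<close> is one, being a summand of \<open>a\<close>.\<close>
      moreover from b a have "Poly_Mapping.keys b \<subseteq> X" by (simp add: keys_add_nat)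
      ultimately have "packs E i (Poly_Mapping.lookup a)"
        using * packs_add by blast
      then show "\<exists>b\<in>edge_sums E i. \<exists>c. a = b + c"
        by (simp add: edge_sums_divides_iff_packs[OF assms])
    qed
    then show "ideal_power X ?I i = integral_closure_power X ?I i"
      unfolding closure ideal_power_edge_ideal[OF assms] monomial_ideal_def by blast
  qed
  \<comment> \<open>As \<open>X\<close> is finite, a function vanishing outside \<open>X\<close> is
    an exponent vector, so quantifying over either amounts to the same.\<close>
  have vector: "\<exists>a. Poly_Mapping.keys a \<subseteq> X \<and> Poly_Mapping.lookup a = f"
    if f: "\<forall>x. x \<notin> X \<longrightarrow> f x = 0" for f :: "'v \<Rightarrow> nat"
  proof -
    from f have "finite {x. f x \<noteq> 0}"
      by (intro finite_subset[OF _ assms(1)]) auto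
    then have "Poly_Mapping.lookup (Abs_poly_mapping f) = f"
      by (rule lookup_Abs_poly_mapping)
    moreover from this f have "Poly_Mapping.keys (Abs_poly_mapping f) \<subseteq> X"
      by (auto simp: in_keys_iff)
    ultimately show ?thesis by blast
  qed
  show ?thesis
    unfolding normal_ideal_def eq
  proof (intro iffI allI impI)
    fix i p :: nat and f
    assume *: "\<forall>i\<ge>1. \<forall>a. Poly_Mapping.keys a \<subseteq> X \<longrightarrow> a \<in> ?A i \<longrightarrow> packs E i (Poly_Mapping.lookup a)"
      and i: "i \<ge> 1" and f: "\<forall>x. x \<notin> X \<longrightarrow> f x = 0"
      and p: "p \<ge> 1" "packs E (p * i) (\<lambda>x. p * f x)"
    from vector[OF f] obtain a where a: "Poly_Mapping.keys a \<subseteq> X" "Poly_Mapping.lookup a = f"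
      by (elim exE conjE)
    with p have "a \<in> ?A i" by (intro CollectI exI[of _ p] conjI) simp_all
    from *[rule_format, OF i a(1) this] a(2) show "packs E i f" by simp
  next
    fix i a
    assume *: ?R and i: "i \<ge> 1" and a: "Poly_Mapping.keys a \<subseteq> X" "a \<in> ?A i"
    from a(2) obtain p where p: "p \<ge> 1" "packs E (p * i) (\<lambda>x. p * Poly_Mapping.lookup a x)"
      by (elim CollectE exE conjE)
    from a(1) have supp: "\<forall>x. x \<notin> X \<longrightarrow> Poly_Mapping.lookup a x = 0"
      by (auto simp: in_keys_iff)
    from *[rule_format, OF i _ p] supp show "packs E i (Poly_Mapping.lookup a)" by simp
  qed
qed

section \<open>Deletion and duplication\<close>

lemma normal_deletion:
  fixes C :: "'v set \<times> 'v set set"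
  assumes C: "finite (fst C)" "snd C \<subseteq> Pow (fst C)"
    and normal: "normal_ideal (fst C) (edge_ideal C :: (('v \<Rightarrow>\<^sub>0 nat) \<Rightarrow>\<^sub>0 'k::field) set)"
  shows "normal_ideal (fst (deletion x C)) (edge_ideal (deletion x C) :: (('v \<Rightarrow>\<^sub>0 nat) \<Rightarrow>\<^sub>0 'k) set)"
proof -
  obtain X E where CXE: "C = (X, E)" by fastforce
  let ?E = "{e \<in> E. x \<notin> e}"
  have fin: "finite X" "E \<subseteq> Pow X" using C by (auto simp: CXE)
  then have fin': "finite (X - {x})" "?E \<subseteq> Pow (X - {x})" by blast+
  have "packs ?E i f"
    if i: "i \<ge> 1" and f: "\<forall>y. y \<notin> X - {x} \<longrightarrow> f y = 0" and p: "p \<ge> 1"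
      and pk: "packs ?E (p * i) (\<lambda>y. p * f y)" for i f p
  proof -
    \<comment> \<open>The edges left by the deletion are edges of the original clutter.\<close>
    from pk have "packs E (p * i) (\<lambda>y. p * f y)" unfolding packs_def by blast
    with normal i f p have "packs E i f"
      unfolding CXE fst_conv normal_edge_ideal_iff[OF fin] by blast
    then obtain es where es: "length es = i" "set es \<subseteq> E" "\<forall>y. mult_in es y \<le> f y"
      unfolding packs_def by blast
    \<comment> \<open>Here \<open>f x = 0\<close>, so no edge of the list contains \<open>x\<close>
      and all of them survive the deletion.\<close>
    from es(3) f have "mult_in es x = 0" by (metis DiffE insertI1 le_0_eq)
    then have "set es \<subseteq> ?E"
      using es(2) by (auto simp: mult_in_def filter_empty_conv)
    with es show ?thesis unfolding packs_def by blast
  qed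
  then show ?thesis
    unfolding deletion_def CXE prod.case fst_conv normal_edge_ideal_iff[OF fin'] by blast
qed

section \<open>Merging a vertex with its duplicate, and splitting it again\<close>

text \<open>An edge containing \<open>x\<close> and \<open>x'\<close> together would be counted once
  after merging but twice in the sum; the first hypothesis excludes it.\<close>

lemma mult_in_merge:
  assumes "\<And>e. e \<in> set es \<Longrightarrow> \<not> (x \<in> e \<and> x' \<in> e)" "x \<noteq> x'"
  shows "mult_in (map (\<lambda>e. if x' \<in> e then insert x (e - {x'}) else e) es) y =
    (if y = x then mult_in es x + mult_in es x' else if y = x' then 0 else mult_in es y)"
  using assms by (induction es) auto

text \<open>Greedy distribution: \<open>m\<close> and \<open>n\<close> are the capacities of
  \<open>x\<close> and \<open>x'\<close>, and each edge through \<open>x\<close> uses one unit of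
  either, keeping \<open>x\<close> or exchanging it for \<open>x'\<close>. The bound
  \<open>m + n\<close> ensures that a unit is always left.\<close>

lemma split_mult_in:
  assumes "set es \<subseteq> E" "mult_in es x \<le> m + n" "x \<noteq> x'" "\<And>e. e \<in> E \<Longrightarrow> x' \<notin> e"
  shows "\<exists>es'. length es' = length es \<and>
    set es' \<subseteq> E \<union> {(e - {x}) \<union> {x'} | e. e \<in> E \<and> x \<in> e} \<and>
    mult_in es' x \<le> m \<and> mult_in es' x' \<le> n \<and>
    (\<forall>y. y \<noteq> x \<longrightarrow> y \<noteq> x' \<longrightarrow> mult_in es' y = mult_in es y)"
  using assms(1,2)
proof (induction es arbitrary: m n)
  case Nil
  then show ?case by simp
next
  case (Cons e es)
  have e: "e \<in> E" "x' \<notin> e" "set es \<subseteq> E" using Cons.prems assms(4) by auto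
  \<comment> \<open>If \<open>x \<in> e\<close>, then \<open>m + n\<close> is positive, so one of
    the capacities is a successor.\<close>
  consider "x \<notin> e" | m' where "x \<in> e" "m = Suc m'" | n' where "x \<in> e" "n = Suc n'"
    using Cons.prems(2) by (cases m; cases n; cases "x \<in> e") auto
  then show ?case
  proof cases
    case 1
    with Cons.IH[of m n] Cons.prems e obtain es' where "length es' = length es"
      "set es' \<subseteq> E \<union> {(e - {x}) \<union> {x'} | e. e \<in> E \<and> x \<in> e}"
      "mult_in es' x \<le> m" "mult_in es' x' \<le> n"
      "\<forall>y. y \<noteq> x \<longrightarrow> y \<noteq> x' \<longrightarrow> mult_in es' y = mult_in es y"
      by auto
    with 1 e show ?thesis by (intro exI[of _ "e # es'"]) simp
  next
    case 2
    with Cons.IH[of m' n] Cons.prems e obtain es' where "length es' = length es"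
      "set es' \<subseteq> E \<union> {(e - {x}) \<union> {x'} | e. e \<in> E \<and> x \<in> e}"
      "mult_in es' x \<le> m'" "mult_in es' x' \<le> n"
      "\<forall>y. y \<noteq> x \<longrightarrow> y \<noteq> x' \<longrightarrow> mult_in es' y = mult_in es y"
      by auto
    with 2 e show ?thesis by (intro exI[of _ "e # es'"]) simp
  next
    case 3
    with Cons.IH[of m n'] Cons.prems e obtain es' where "length es' = length es"
      "set es' \<subseteq> E \<union> {(e - {x}) \<union> {x'} | e. e \<in> E \<and> x \<in> e}"
      "mult_in es' x \<le> m" "mult_in es' x' \<le> n'"
      "\<forall>y. y \<noteq> x \<longrightarrow> y \<noteq> x' \<longrightarrow> mult_in es' y = mult_in es y"
      by auto
    with 3 e \<open>x \<noteq> x'\<close> show ?thesis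
      by (intro exI[of _ "((e - {x}) \<union> {x'}) # es'"]) auto
  qed
qed

lemma normal_duplication:
  fixes C :: "'v set \<times> 'v set set"
  assumes C: "finite (fst C)" "snd C \<subseteq> Pow (fst C)"
    and x: "x \<in> fst C" "x' \<notin> fst C"
    and normal: "normal_ideal (fst C) (edge_ideal C :: (('v \<Rightarrow>\<^sub>0 nat) \<Rightarrow>\<^sub>0 'k::field) set)"
  shows "normal_ideal (fst (duplication x x' C))
    (edge_ideal (duplication x x' C) :: (('v \<Rightarrow>\<^sub>0 nat) \<Rightarrow>\<^sub>0 'k) set)"
proof -
  obtain X E where CXE: "C = (X, E)" by fastforce
  let ?E = "E \<union> {(e - {x}) \<union> {x'} | e. e \<in> E \<and> x \<in> e}"
  have fin: "finite X" "E \<subseteq> Pow X" using C by (auto simp: CXE)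
  then have fin': "finite (insert x' X)" "?E \<subseteq> Pow (insert x' X)" by auto
  have xX: "x \<in> X" "x' \<notin> X" "x \<noteq> x'" using x by (auto simp: CXE)
  with fin(2) have x'E: "x' \<notin> e" if "e \<in> E" for e using that by blast
  have "packs ?E i f"
    if i: "i \<ge> 1" and f: "\<forall>y. y \<notin> insert x' X \<longrightarrow> f y = 0" and p: "p \<ge> 1"
      and pk: "packs ?E (p * i) (\<lambda>y. p * f y)" for i f p
  proof -
    \<comment> \<open>The image of \<open>f\<close> under the identification of \<open>x'\<close>
      with \<open>x\<close>; the value 0 at \<open>x'\<close> makes \<open>g\<close> vanish outside
      \<open>X\<close>.\<close>
    define g where "g y = (if y = x then f x + f x' else if y = x' then 0 else f y)" for y
    define merge where "merge e = (if x' \<in> e then insert x (e - {x'}) else e)" for e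
    from pk obtain es where es: "length es = p * i" "set es \<subseteq> ?E" "\<forall>y. mult_in es y \<le> p * f y"
      unfolding packs_def by blast
    \<comment> \<open>Old edges avoid \<open>x'\<close>, and new edges have given up
      \<open>x\<close>.\<close>
    have "\<not> (x \<in> e \<and> x' \<in> e)" if "e \<in> set es" for e
      using that es(2) x'E xX by blast
    from mult_in_merge[where es = es, OF this xX(3)]
    \<comment> \<open>Merging adds the counts at \<open>x\<close> and \<open>x'\<close>, so by
      distributivity it respects the factor \<open>p\<close>.\<close>
    have "mult_in (map merge es) y \<le> p * g y" for y
      using es(3) by (auto simp: merge_def[abs_def] g_def distrib_left intro: add_mono)
    \<comment> \<open>Merging fixes the old edges and sends each new edge back to the edge it was
      copied from.\<close>
    moreover have "merge e \<in> E" if "e \<in> ?E" for e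
    proof (cases "e \<in> E")
      case True
      then show ?thesis using x'E by (simp add: merge_def)
    next
      case False
      with that obtain d where d: "e = (d - {x}) \<union> {x'}" "d \<in> E" "x \<in> d" by blast
      then have "merge e = d" using x'E by (auto simp: merge_def)
      with d show ?thesis by simp
    qed
    then have "set (map merge es) \<subseteq> E" using es(2) unfolding set_map by blast
    ultimately have "packs E (p * i) (\<lambda>y. p * g y)"
      unfolding packs_def using es(1) by (metis length_map)
    moreover have "\<forall>y. y \<notin> X \<longrightarrow> g y = 0" using f xX by (auto simp: g_def)
    ultimately have "packs E i g"
      using normal i p unfolding CXE fst_conv normal_edge_ideal_iff[OF fin] by blast
    then obtain ds where ds: "length ds = i" "set ds \<subseteq> E" "\<forall>y. mult_in ds y \<le> g y"
      unfolding packs_def by blast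
    \<comment> \<open>The bound \<open>g x\<close> is exactly the joint capacity, to be split into
      \<open>f x\<close> for \<open>x\<close> and \<open>f x'\<close> for \<open>x'\<close>.\<close>
    from ds(3) have "mult_in ds x \<le> f x + f x'" by (metis g_def)
    from split_mult_in[OF ds(2) this xX(3) x'E] obtain ds' where ds': "length ds' = i"
      "set ds' \<subseteq> ?E" "mult_in ds' x \<le> f x" "mult_in ds' x' \<le> f x'"
      "\<forall>y. y \<noteq> x \<longrightarrow> y \<noteq> x' \<longrightarrow> mult_in ds' y = mult_in ds y"
      using ds(1) by blast
    have "mult_in ds' y \<le> f y" for y
      using ds'(3-5) ds(3) by (metis g_def)
    with ds' show ?thesis unfolding packs_def by blast
  qed
  then show ?thesis
    unfolding duplication_def CXE prod.case fst_conv normal_edge_ideal_iff[OF fin'] by blast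
qed

theorem theorem3p1p3:
  fixes C C' :: "'v set \<times> 'v set set"
  assumes "clutter C"
    and "parallelization C C'"
    and "normal_ideal (fst C) (edge_ideal C :: (('v \<Rightarrow>\<^sub>0 nat) \<Rightarrow>\<^sub>0 'k::field) set)"
  shows "normal_ideal (fst C') (edge_ideal C' :: (('v \<Rightarrow>\<^sub>0 nat) \<Rightarrow>\<^sub>0 'k) set)"
proof -
  \<comment> \<open>The induction carries along finiteness and the inclusion of the edges in the
    vertex set, on which the packing form of normality rests at each stage.\<close>
  from assms(2) have "finite (fst C') \<and> snd C' \<subseteq> Pow (fst C') \<and>
    normal_ideal (fst C') (edge_ideal C' :: (('v \<Rightarrow>\<^sub>0 nat) \<Rightarrow>\<^sub>0 'k) set)"
  proof induction
    case refl
    then show ?case using assms(1,3) by (cases C) (simp add: clutter_def)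
  next
    case (deletion D x)
    moreover from deletion.IH have "finite (fst (deletion x D))"
      "snd (deletion x D) \<subseteq> Pow (fst (deletion x D))"
      by (cases D; auto simp: deletion_def)+
    ultimately show ?case using normal_deletion[of D x] by blast
  next
    case (duplication D x x')
    moreover from duplication.IH have "finite (fst (duplication x x' D))"
      "snd (duplication x x' D) \<subseteq> Pow (fst (duplication x x' D))"
      by (cases D; auto simp: duplication_def)+
    ultimately show ?case using normal_duplication[of D x x'] by blast
  qed
  then show ?thesis by blast
qed

end
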